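(* Every isotropic V-net $F:\mathbb{Z}^2\to I^3$ can be embedded into a continuous family of isometric isotropic V-nets $F(t)$.
   Context: $I^3$ is $\mathbb{R}^3$; the top view of $(x,y,z)$ is $(x,y)$. A discrete Q-net is a map $F:\mathbb{Z}^2\to\mathbb{R}^3$ such that each face $F_{ij}F_{i+1,j}F_{i+1,j+1}F_{i,j+1}$ is planar; face planes are assumed not parallel to the $z$-axis and the faces non-degenerate. An isotropic V-net (isotropic Voss net) is a discrete Q-net in which all parameter lines ($i$ fixed or $j$ fixed) are discrete geodesics, i.e. appear as straight lines in the top view. Metric duality $\nu$: the point $(a,b,w)$ corresponds to the plane $bx-ay+z-w=0$ and vice versa. For a Q-net $F$ with face planes $\pi_{ij}$, $\nu(F)$ is the net with vertices $\nu(\pi_{ij})$; its face corresponding to the vertex $F_{ij}$ is the quadrilateral $\nu(\pi_{i-1,j-1}),\nu(\pi_{i,j-1}),\nu(\pi_{ij}),\nu(\pi_{i-1,j})$, lying in the plane $\nu(F_{ij})$. Two discrete Q-nets $F,\bar F$ are isometric in $I^3$ if corresponding vertices have the same top view and corresponding faces of the metric duals $\nu(F)$ and $\nu(\bar F)$ have the same area in the top view (a discrete version of equality of the isotropic Gaussian curvature; $\nu(F)$ and $\nu(\bar F)$ are then Combescure transforms of each other, i.e. corresponding edges are parallel, with equal areas of corresponding faces). "Embedded into a continuous family" means that there is a non-constant family $F(t)$ depending continuously on a real parameter $t$, with $F(t_0)=F$ for some $t_0$, all of whose members are isometric isotropic V-nets. *)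

theory Defs
  imports "HOL-Analysis.Analysis"
begin

definition top_view :: "real^3 \<Rightarrow> real^2" where
  "top_view p = vector [p$1, p$2]"

text \<open>
  A net is a map from the integer grid to space. The face with index \<open>(i, j)\<close> is the quadrilateral
  whose vertices, in cyclic order, are those of \<open>(i, j)\<close>, \<open>(i+1, j)\<close>, \<open>(i+1, j+1)\<close>, \<open>(i, j+1)\<close>.
\<close>

type_synonym net = "int \<Rightarrow> int \<Rightarrow> real^3"

definition face :: "net \<Rightarrow> int \<Rightarrow> int \<Rightarrow> (real^3) set" where
  "face F i j = {F i j, F (i+1) j, F (i+1) (j+1), F i (j+1)}"

definition face_plane :: "net \<Rightarrow> int \<Rightarrow> int \<Rightarrow> (real^3) set" where
  "face_plane F i j = affine hull face F i j"

text \<open>A face is non-degenerate if no three of its four vertices are collinear.\<close>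

definition nondegenerate_face :: "net \<Rightarrow> int \<Rightarrow> int \<Rightarrow> bool" where
  "nondegenerate_face F i j \<longleftrightarrow>
     \<not> collinear {F i j, F (i+1) j, F (i+1) (j+1)} \<and>
     \<not> collinear {F (i+1) j, F (i+1) (j+1), F i (j+1)} \<and>
     \<not> collinear {F (i+1) (j+1), F i (j+1), F i j} \<and>
     \<not> collinear {F i (j+1), F i j, F (i+1) j}"

text \<open>Intended for affine subspaces, where the choice of the point \<open>p\<close> is irrelevant.\<close>

definition parallel_to_z_axis :: "(real^3) set \<Rightarrow> bool" where
  "parallel_to_z_axis S \<longleftrightarrow> (\<exists>p\<in>S. p + axis 3 1 \<in> S)"

definition Q_net :: "net \<Rightarrow> bool" where
  "Q_net F \<longleftrightarrow>
     (\<forall>i j. coplanar (face F i j) \<and> nondegenerate_face F i j \<and>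
            \<not> parallel_to_z_axis (face_plane F i j))"

definition isotropic_V_net :: "net \<Rightarrow> bool" where
  "isotropic_V_net F \<longleftrightarrow>
     Q_net F \<and>
     (\<forall>i. collinear (range (\<lambda>j. top_view (F i j)))) \<and>
     (\<forall>j. collinear (range (\<lambda>i. top_view (F i j))))"

definition dual_plane :: "real^3 \<Rightarrow> (real^3) set" where
  "dual_plane p = {q. p$2 * q$1 - p$1 * q$2 + q$3 - p$3 = 0}"

lemma inj_dual_plane: "inj dual_plane"
proof (rule injI)
  fix p p' :: "real^3"
  assume eq: "dual_plane p = dual_plane p'"
  have *: "p$2 * x - p$1 * y + z - p$3 = 0 \<longleftrightarrow> p'$2 * x - p'$1 * y + z - p'$3 = 0" for x y z
  proof -
    have "vector [x, y, z] \<in> dual_plane p \<longleftrightarrow> vector [x, y, z] \<in> dual_plane p'"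
      by (simp only: eq)
    then show ?thesis
      by (simp add: dual_plane_def)
  qed
  have 3: "p$3 = p'$3"
    using *[of 0 0 "p$3"] by simp
  have "p$2 = p'$2" "p$1 = p'$1"
    using *[of 1 0 "p$3 - p$2"] *[of 0 1 "p$3 + p$1"] 3 by simp_all
  with 3 show "p = p'"
    by (simp add: vec_eq_iff forall_3)
qed

text \<open>
  Metric duality on planes, meaningful for planes not parallel to the z-axis: these are exactly the
  sets in the range of \<^const>\<open>dual_plane\<close>.
\<close>

definition dual_point :: "(real^3) set \<Rightarrow> real^3" where
  "dual_point = the_inv dual_plane"

definition dual_net :: "net \<Rightarrow> net" where
  "dual_net F i j = dual_point (face_plane F i j)"

definition cross2 :: "real^2 \<Rightarrow> real^2 \<Rightarrow> real" where
  "cross2 u v = u$1 * v$2 - u$2 * v$1"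

text \<open>Oriented area of the quadrilateral \<open>a b c d\<close> by the shoelace formula.\<close>

definition quad_area :: "real^2 \<Rightarrow> real^2 \<Rightarrow> real^2 \<Rightarrow> real^2 \<Rightarrow> real" where
  "quad_area a b c d = (cross2 a b + cross2 b c + cross2 c d + cross2 d a) / 2"

definition dual_face_area :: "net \<Rightarrow> int \<Rightarrow> int \<Rightarrow> real" where
  "dual_face_area F i j =
     quad_area (top_view (dual_net F (i-1) (j-1))) (top_view (dual_net F i (j-1)))
               (top_view (dual_net F i j)) (top_view (dual_net F (i-1) j))"

text \<open>
  The areas are compared with their signs, since the dual face area is a discrete version of the
  isotropic Gaussian curvature, which is a signed quantity.
\<close>

definition isometric_nets :: "net \<Rightarrow> net \<Rightarrow> bool" where
  "isometric_nets F F' \<longleftrightarrow>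
     (\<forall>i j. top_view (F' i j) = top_view (F i j)) \<and>
     (\<forall>i j. dual_face_area F' i j = dual_face_area F i j)"

text \<open>
  The motions of isotropic space: Euclidean motions in the top view, combined with the addition of
  an affine function of the top view to the height.
\<close>

definition isotropic_motion :: "(real^3 \<Rightarrow> real^3) \<Rightarrow> bool" where
  "isotropic_motion g \<longleftrightarrow>
     (\<exists>\<phi> a b c c1 c2. \<forall>p. g p =
        vector [a + p$1 * cos \<phi> - p$2 * sin \<phi>,
                b + p$1 * sin \<phi> + p$2 * cos \<phi>,
                c + c1 * p$1 + c2 * p$2 + p$3])"

definition isotropic_congruent :: "net \<Rightarrow> net \<Rightarrow> bool" where
  "isotropic_congruent F F' \<longleftrightarrow> (\<exists>g. isotropic_motion g \<and> (\<forall>i j. F' i j = g (F i j)))"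

lemma isotropic_congruent_refl: "isotropic_congruent F F"
proof -
  have "isotropic_motion id"
    unfolding isotropic_motion_def
    by (intro exI[of _ 0]) (simp add: vec_eq_iff forall_3)
  then show ?thesis
    unfolding isotropic_congruent_def by (intro exI[of _ id]) simp
qed

text \<open>
  Every net lies in trivial families of isometric nets such as its vertical translates. A family is
  therefore called non-constant only if it is so up to isotropic congruence; by
  \<open>isotropic_congruent_refl\<close> it is then also non-constant as a map.
\<close>

definition continuous_isometric_V_net_family :: "(real \<Rightarrow> net) \<Rightarrow> bool" where
  "continuous_isometric_V_net_family G \<longleftrightarrow>
     (\<forall>i j. continuous_on UNIV (\<lambda>t. G t i j)) \<and>
     (\<exists>s t. \<not> isotropic_congruent (G s) (G t)) \<and>
     (\<forall>t. isotropic_V_net (G t)) \<and>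
     (\<forall>s t. isometric_nets (G s) (G t))"

end

theory Submission imports Defs begin

text \<open>
  A plane that is not vertical is the graph of an affine function on the top view, and its dual
  point \<open>n\<close> is a coordinate vector of that function: the height above \<open>x\<close> is
  \<open>n$3 + cross2 (top_view n) x\<close>, which is linear in \<open>n\<close>. Hence sums and multiples of dual points
  are sums and multiples of affine functions, and a Q-net with top view \<open>f\<close> is given by the dual
  points \<open>n i j\<close> of its faces, subject to the condition that the affine functions of adjacent faces
  agree along their common edge.

  In a V-net the edges on one parameter line are collinear in the top view. So
  \<open>n i j - n (i-1) j\<close>, which vanishes on one edge of the line \<open>i\<close>, vanishes on the whole line; the
  mixed difference \<open>n i j - n (i-1) j - n i (j-1) + n (i-1) (j-1)\<close> vanishes on two lines that cross
  transversally and is therefore \<open>0\<close>. This yields a splitting \<open>n i j = P i + Q j\<close>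
  (\<open>V_net_splits\<close>), in which \<open>P\<close> changes only across the lines with constant \<open>i\<close> and \<open>Q\<close> only
  across the lines with constant \<open>j\<close>. Conversely every such pair gives a V-net
  (\<open>folded_V_net\<close>). The faces of the dual net are parallelograms, spanned by one increment of \<open>P\<close>
  and one increment of \<open>Q\<close> (\<open>dual_face_area_folded\<close>), so
  replacing \<open>P\<close> by \<open>exp t\<close> times \<open>P\<close> and \<open>Q\<close> by \<open>exp (- t)\<close> times \<open>Q\<close> keeps all their areas.

  This deformation is a mere congruence exactly if all face planes of the net coincide. But then
  all dual areas vanish, and they remain \<open>0\<close> when the net is folded along a single parameter line
  by a variable amount.
\<close>

section \<open>Planes as affine functions on the top view\<close>

definition height :: "real^3 \<Rightarrow> real^2 \<Rightarrow> real" where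
  "height n x = n$3 + cross2 (top_view n) x"

definition lift :: "real^3 \<Rightarrow> real^2 \<Rightarrow> real^3" where
  "lift n x = vector [x$1, x$2, height n x]"

lemma top_view_component [simp]: "top_view p $ 1 = p$1" "top_view p $ 2 = p$2"
  by (simp_all add: top_view_def)

lemma linear_top_view: "linear top_view"
  by (rule linearI) (simp_all add: vec_eq_iff forall_2)

lemma height_alt: "height n x = n$3 + n$1 * x$2 - n$2 * x$1"
  by (simp add: height_def cross2_def)

lemma lift_component [simp]:
  "lift n x $ 1 = x$1" "lift n x $ 2 = x$2" "lift n x $ 3 = height n x"
  by (simp_all add: lift_def)

lemma top_view_lift [simp]: "top_view (lift n x) = x"
  by (simp add: vec_eq_iff forall_2)

lemma mem_dual_plane_iff: "q \<in> dual_plane n \<longleftrightarrow> q$3 = height n (top_view q)"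
  by (auto simp: dual_plane_def height_alt algebra_simps)

lemma mem_dual_plane_iff_lift: "q \<in> dual_plane n \<longleftrightarrow> q = lift n (top_view q)"
  by (simp add: mem_dual_plane_iff vec_eq_iff forall_3)

lemma height_zero [simp]: "height 0 x = 0"
  by (simp add: height_alt)

lemma height_add: "height (m + n) x = height m x + height n x"
  by (simp add: height_alt algebra_simps)

lemma height_diff: "height (m - n) x = height m x - height n x"
  by (simp add: height_alt algebra_simps)

lemma height_scaleR: "height (c *\<^sub>R n) x = c * height n x"
  by (simp add: height_alt algebra_simps)

lemma height_affine_combination:
  "height n (u *\<^sub>R x + (1 - u) *\<^sub>R y) = u * height n x + (1 - u) * height n y"
  by (simp add: height_alt algebra_simps)

lemma height_zero_on_line:
  assumes "height n x = 0" "height n z = 0" "x \<noteq> z" "collinear {x, y, z}"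
  shows "height n y = 0"
  using assms by (auto simp: collinear_3_expand height_affine_combination)

lemma height_zero_on_collinear:
  assumes "height n x = 0" "height n z = 0" "x \<noteq> z" "collinear S" "x \<in> S" "y \<in> S" "z \<in> S"
  shows "height n y = 0"
  by (rule height_zero_on_line[OF assms(1-3)])
     (use assms in \<open>auto intro: collinear_subset\<close>)

lemma collinear_if_height_zero:
  assumes "n \<noteq> 0" "height n x = 0" "height n y = 0" "height n z = 0"
  shows "collinear {x, y, z}"
proof -
  have x: "n$3 = n$2 * x$1 - n$1 * x$2" and y: "n$1 * (y$2 - x$2) = n$2 * (y$1 - x$1)"
    and z: "n$1 * (z$2 - x$2) = n$2 * (z$1 - x$1)"
    using assms(2-) by (simp_all add: height_alt algebra_simps)
  define d where "d = top_view n"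
  have "n$1 \<noteq> 0 \<or> n$2 \<noteq> 0"
    using assms(1) x by (auto simp: vec_eq_iff forall_3)
  then have "\<exists>c. p - x = c *\<^sub>R d" if "n$1 * (p$2 - x$2) = n$2 * (p$1 - x$1)" for p
  proof
    assume "n$1 \<noteq> 0"
    with that show ?thesis
      by (intro exI[of _ "(p$1 - x$1) / n$1"]) (simp add: vec_eq_iff forall_2 d_def field_simps)
  next
    assume "n$2 \<noteq> 0"
    with that show ?thesis
      by (intro exI[of _ "(p$2 - x$2) / n$2"]) (simp add: vec_eq_iff forall_2 d_def field_simps)
  qed
  then obtain a b where "y - x = a *\<^sub>R d" "z - x = b *\<^sub>R d"
    using y z by meson
  then have "x = x + 0 *\<^sub>R d" "y = x + a *\<^sub>R d" "z = x + b *\<^sub>R d"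
    by (simp_all add: algebra_simps)
  then have "\<forall>p\<in>{x, y, z}. \<exists>c. p = x + c *\<^sub>R d"
    by blast
  then show ?thesis
    unfolding collinear_alt by blast
qed

lemma height_eq_imp_eq:
  assumes "\<not> collinear {x, y, z}"
    "height m x = height n x" "height m y = height n y" "height m z = height n z"
  shows "m = n"
  using collinear_if_height_zero[of "m - n" x y z] assms by (auto simp: height_diff)

lemma collinear_affine_image:
  assumes "linear g" "\<And>x y. h x - h y = g (x - y)" "collinear S"
  shows "collinear (h ` S)"
proof -
  obtain u where u: "\<And>x y. x \<in> S \<Longrightarrow> y \<in> S \<Longrightarrow> \<exists>c. x - y = c *\<^sub>R u"
    using assms(3) by (auto simp: collinear_def)
  have "\<exists>c. h x - h y = c *\<^sub>R g u" if "x \<in> S" "y \<in> S" for x y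
    using u[OF that] assms(1,2) by (auto simp: linear_scale)
  then show ?thesis
    unfolding collinear_def by blast
qed

text \<open>
  Lifting to a plane is an affine map with inverse \<^const>\<open>top_view\<close>, so non-degeneracy of a face is
  a property of its top view.
\<close>

lemma collinear_lift_iff: "collinear (lift n ` S) \<longleftrightarrow> collinear S"
proof
  assume "collinear (lift n ` S)"
  then have "collinear (top_view ` lift n ` S)"
    by (rule collinear_affine_image[OF linear_top_view, rotated])
       (simp add: linear_diff[OF linear_top_view])
  then show "collinear S"
    by (simp add: image_image)
next
  have "linear (\<lambda>x. lift n x - lift n 0)"
    by (rule linearI) (simp_all add: vec_eq_iff forall_3 height_alt algebra_simps)
  moreover have "lift n x - lift n y = lift n (x - y) - lift n 0" for x y
    by (simp add: vec_eq_iff forall_3 height_alt algebra_simps)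
  moreover assume "collinear S"
  ultimately show "collinear (lift n ` S)"
    by (rule collinear_affine_image)
qed

lemma dual_plane_eq_hyperplane:
  "dual_plane n = {q. vector [n$2, - n$1, 1] \<bullet> q = n$3}"
  by (auto simp: dual_plane_def inner_vec_def sum_3)

lemma aff_dim_dual_plane: "aff_dim (dual_plane n) = 2"
proof -
  have "(vector [n$2, - n$1, 1] :: real^3) \<noteq> 0"
    by (simp add: vec_eq_iff forall_3)
  then show ?thesis
    by (simp add: dual_plane_eq_hyperplane)
qed

lemma affine_hull_eq_dual_plane:
  assumes "S \<subseteq> dual_plane n" "T \<subseteq> S" "\<not> collinear T"
  shows "affine hull S = dual_plane n"
proof -
  have "aff_dim S = aff_dim (dual_plane n)"
    using assms(3) aff_dim_subset[OF assms(1)] aff_dim_subset[OF assms(2)]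
    by (simp add: collinear_aff_dim aff_dim_dual_plane)
  then have "affine hull S = affine hull dual_plane n"
    using aff_dim_eq_full_gen[OF assms(1)] by blast
  also have "\<dots> = dual_plane n"
    by (simp add: dual_plane_eq_hyperplane affine_hyperplane)
  finally show ?thesis .
qed

lemma not_parallel_dual_plane: "\<not> parallel_to_z_axis (dual_plane n)"
  by (auto simp: parallel_to_z_axis_def dual_plane_def axis_def)

lemma dual_point_dual_plane [simp]: "dual_point (dual_plane n) = n"
  by (simp add: dual_point_def the_inv_f_f inj_dual_plane)

lemma Q_net_face_plane:
  assumes "Q_net F"
  shows "face_plane F i j = dual_plane (dual_net F i j)"
proof -
  let ?S = "face F i j"
  have cop: "coplanar ?S" and np: "\<not> parallel_to_z_axis (affine hull ?S)"
    and nc: "\<not> collinear {F i j, F (i+1) j, F (i+1) (j+1)}"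
    using assms by (auto simp: Q_net_def nondegenerate_face_def face_plane_def)
  obtain u v w where "?S \<subseteq> affine hull {u, v, w}"
    using cop unfolding coplanar_def by blast
  then have "aff_dim ?S \<le> aff_dim {u, v, w}"
    using aff_dim_subset[of ?S "affine hull {u, v, w}"] by simp
  also have "\<dots> \<le> int (card {u, v, w}) - 1"
    by (rule aff_dim_le_card) simp
  also have "\<dots> \<le> 2"
    using card_length[of "[u, v, w]"] by simp
  finally have "aff_dim ?S \<le> 2" .
  moreover have "aff_dim {F i j, F (i+1) j, F (i+1) (j+1)} \<le> aff_dim ?S"
    by (rule aff_dim_subset) (auto simp: face_def)
  ultimately have "aff_dim ?S = DIM(real^3) - 1"
    using nc by (simp add: collinear_aff_dim)
  then obtain a b where a: "a \<noteq> 0" "affine hull ?S = {x. a \<bullet> x = b}"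
    unfolding aff_dim_eq_hyperplane by blast
  have "a$3 \<noteq> 0"
  proof
    assume 0: "a$3 = 0"
    have "F i j \<in> affine hull ?S"
      by (rule hull_inc) (simp add: face_def)
    then have "F i j + axis 3 1 \<in> affine hull ?S"
      unfolding a by (simp add: inner_add_right inner_axis 0)
    with \<open>F i j \<in> affine hull ?S\<close> np show False
      unfolding parallel_to_z_axis_def by blast
  qed
  have "a \<bullet> q - b = a$3 * (a$1 / a$3 * q$1 - (- a$2 / a$3) * q$2 + q$3 - b / a$3)" for q
    using \<open>a$3 \<noteq> 0\<close> by (simp add: inner_vec_def sum_3 algebra_simps)
  then have "a \<bullet> q = b \<longleftrightarrow> a$1 / a$3 * q$1 - (- a$2 / a$3) * q$2 + q$3 - b / a$3 = 0" for q
    using \<open>a$3 \<noteq> 0\<close> by (metis eq_iff_diff_eq_0 mult_eq_0_iff)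
  then have "affine hull ?S = dual_plane (vector [- a$2 / a$3, a$1 / a$3, b / a$3])"
    unfolding a dual_plane_def by simp
  then show ?thesis
    by (simp add: dual_net_def face_plane_def)
qed

section \<open>Folded nets\<close>

text \<open>
  The possible top views of V-nets. Non-degeneracy is what makes two crossing parameter lines
  transversal.
\<close>

locale straight_grid =
  fixes f :: "int \<Rightarrow> int \<Rightarrow> real^2"
  assumes line1: "collinear (range (\<lambda>j. f i j))"
    and line2: "collinear (range (\<lambda>i. f i j))"
    and not_collinear:
      "\<not> collinear {f i j, f (i+1) j, f (i+1) (j+1)}"
      "\<not> collinear {f (i+1) j, f (i+1) (j+1), f i (j+1)}"
      "\<not> collinear {f (i+1) (j+1), f i (j+1), f i j}"
      "\<not> collinear {f i (j+1), f i j, f (i+1) j}"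
begin

lemma edge_nonzero: "f i j \<noteq> f i (j+1)" "f i j \<noteq> f (i+1) j"
  using not_collinear(4)[of i j] by (auto simp: insert_commute)

lemma height_zero_line1:
  assumes "height n (f i j) = 0" "height n (f i (j+1)) = 0"
  shows "height n (f i k) = 0"
  by (rule height_zero_on_collinear[OF assms edge_nonzero(1) line1[of i]]) auto

lemma height_zero_line2:
  assumes "height n (f i j) = 0" "height n (f (i+1) j) = 0"
  shows "height n (f k j) = 0"
  by (rule height_zero_on_collinear[OF assms edge_nonzero(2) line2[of j]]) auto

definition folds1 :: "(int \<Rightarrow> real^3) \<Rightarrow> bool" where
  "folds1 P \<longleftrightarrow> (\<forall>i j. height (P i) (f (i+1) j) = height (P (i+1)) (f (i+1) j))"

definition folds2 :: "(int \<Rightarrow> real^3) \<Rightarrow> bool" where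
  "folds2 Q \<longleftrightarrow> (\<forall>i j. height (Q j) (f i (j+1)) = height (Q (j+1)) (f i (j+1)))"

definition folded :: "(int \<Rightarrow> real^3) \<Rightarrow> (int \<Rightarrow> real^3) \<Rightarrow> net" where
  "folded P Q i j = lift (P i + Q j) (f i j)"

lemma top_view_folded [simp]: "top_view (folded P Q i j) = f i j"
  by (simp add: folded_def)

lemma folds1_scaleR: "folds1 P \<Longrightarrow> folds1 (\<lambda>i. c *\<^sub>R P i)"
  by (simp add: folds1_def height_scaleR)

lemma folds2_scaleR: "folds2 Q \<Longrightarrow> folds2 (\<lambda>j. c *\<^sub>R Q j)"
  by (simp add: folds2_def height_scaleR)

text \<open>
  The heights prescribed by the four faces around a vertex agree there, so that the whole face
  \<open>(i, j)\<close> lies in the plane with dual point \<open>P i + Q j\<close>.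
\<close>

lemma folded_on_face:
  assumes "folds1 P" "folds2 Q"
  shows "folded P Q i j = lift (P i + Q j) (f i j)"
    "folded P Q (i+1) j = lift (P i + Q j) (f (i+1) j)"
    "folded P Q i (j+1) = lift (P i + Q j) (f i (j+1))"
    "folded P Q (i+1) (j+1) = lift (P i + Q j) (f (i+1) (j+1))"
  using assms
  by (simp_all add: folded_def vec_eq_iff forall_3 height_add folds1_def folds2_def)

lemma folded_nondegenerate:
  assumes "folds1 P" "folds2 Q"
  shows "nondegenerate_face (folded P Q) i j"
proof -
  have "\<not> collinear {lift n x, lift n y, lift n z}" if "\<not> collinear {x, y, z}" for n x y z
    using that collinear_lift_iff[of n "{x, y, z}"] by simp
  then show ?thesis
    unfolding nondegenerate_face_def folded_on_face[OF assms, of i j] using not_collinear by blast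
qed

lemma folded_face_plane:
  assumes "folds1 P" "folds2 Q"
  shows "face_plane (folded P Q) i j = dual_plane (P i + Q j)"
  unfolding face_plane_def
proof (rule affine_hull_eq_dual_plane)
  show "face (folded P Q) i j \<subseteq> dual_plane (P i + Q j)"
    by (simp add: face_def folded_on_face[OF assms, of i j] mem_dual_plane_iff)
  show "\<not> collinear {folded P Q i j, folded P Q (i+1) j, folded P Q (i+1) (j+1)}"
    using folded_nondegenerate[OF assms] by (simp add: nondegenerate_face_def)
qed (auto simp: face_def)

lemma folded_dual_net:
  assumes "folds1 P" "folds2 Q"
  shows "dual_net (folded P Q) i j = P i + Q j"
  by (simp add: dual_net_def folded_face_plane[OF assms])

lemma folded_V_net:
  assumes "folds1 P" "folds2 Q"
  shows "isotropic_V_net (folded P Q)"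
proof -
  have "coplanar (face (folded P Q) i j)" for i j
  proof -
    let ?T = "{folded P Q i j, folded P Q (i+1) j, folded P Q (i+1) (j+1)}"
    have "affine hull ?T = dual_plane (P i + Q j)"
    proof (rule affine_hull_eq_dual_plane)
      show "\<not> collinear ?T"
        using folded_nondegenerate[OF assms] by (simp add: nondegenerate_face_def)
    qed (simp_all add: folded_on_face[OF assms, of i j] mem_dual_plane_iff)
    then have "face (folded P Q) i j \<subseteq> affine hull ?T"
      by (simp add: face_def folded_on_face[OF assms, of i j] mem_dual_plane_iff)
    then show ?thesis
      unfolding coplanar_def by blast
  qed
  then show ?thesis
    using folded_nondegenerate[OF assms] line1 line2
    by (simp add: isotropic_V_net_def Q_net_def folded_face_plane[OF assms]
        not_parallel_dual_plane)
qed

lemma dual_face_area_folded: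
  assumes "folds1 P" "folds2 Q"
  shows "dual_face_area (folded P Q) i j =
    cross2 (top_view (P i - P (i-1))) (top_view (Q j - Q (j-1)))"
  by (simp add: dual_face_area_def folded_dual_net[OF assms] quad_area_def cross2_def
      field_simps)

text \<open>
  Whatever it does to the top view, an isotropic motion adds to the height a single affine function
  \<open>c\<close> of the old top view. For two nets over the same \<open>f\<close>, this \<open>c\<close> is then the common difference
  of the affine functions of all pairs of corresponding faces.
\<close>

lemma congruent_folded_dual_shift:
  assumes "folds1 P" "folds2 Q" "folds1 P'" "folds2 Q'"
    and "isotropic_congruent (folded P Q) (folded P' Q')"
  shows "\<exists>c. \<forall>i j. P' i + Q' j = P i + Q j + c"
proof -
  obtain \<phi> a b c c1 c2 where g: "folded P' Q' i j =
        (let p = folded P Q i j in vector [a + p$1 * cos \<phi> - p$2 * sin \<phi>,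
                b + p$1 * sin \<phi> + p$2 * cos \<phi>,
                c + c1 * p$1 + c2 * p$2 + p$3])" for i j
    using assms(5) unfolding isotropic_congruent_def isotropic_motion_def by (auto simp: Let_def)
  \<comment> \<open>The linear function \<open>c1 x + c2 y + c\<close> in the coordinates of \<open>height\<close>.\<close>
  define m :: "real^3" where "m = vector [c2, - c1, c]"
  have 3: "folded P' Q' i j $ 3 = folded P Q i j $ 3 + height m (f i j)" for i j
    using g[of i j] by (simp add: Let_def folded_def m_def height_alt)
  have "P' i + Q' j = P i + Q j + m" for i j
  proof (rule height_eq_imp_eq[OF not_collinear(1)[of i j]])
    show "height (P' i + Q' j) (f i j) = height (P i + Q j + m) (f i j)"
      using 3[of i j] by (simp add: folded_on_face[OF assms(1,2), of i j] folded_on_face[OF assms(3,4), of i j]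
          height_add)
    show "height (P' i + Q' j) (f (i+1) j) = height (P i + Q j + m) (f (i+1) j)"
      using 3[of "i+1" j] by (simp add: folded_on_face[OF assms(1,2), of i j] folded_on_face[OF assms(3,4), of i j]
          height_add)
    show "height (P' i + Q' j) (f (i+1) (j+1)) = height (P i + Q j + m) (f (i+1) (j+1))"
      using 3[of "i+1" "j+1"] by (simp add: folded_on_face[OF assms(1,2), of i j] folded_on_face[OF assms(3,4), of i j]
          height_add)
  qed
  then show ?thesis by blast
qed

text \<open>
  The two scaling factors enter the dual areas through their product only. The last assumption says
  that the affine functions of the faces do not all change by the same amount from \<open>t = 0\<close> to
  \<open>t = 1\<close>, which excludes a congruence by the preceding lemma.
\<close>

lemma scaled_family:
  assumes P: "folds1 P" and Q: "folds2 Q"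
    and cont: "continuous_on UNIV a" "continuous_on UNIV b"
    and area: "\<And>s t i j. a s * b s * cross2 (top_view (P i - P (i-1))) (top_view (Q j - Q (j-1)))
                        = a t * b t * cross2 (top_view (P i - P (i-1))) (top_view (Q j - Q (j-1)))"
    and nonconst: "\<And>c. \<exists>i j. (a 1 - a 0) *\<^sub>R P i + (b 1 - b 0) *\<^sub>R Q j \<noteq> c"
  shows "continuous_isometric_V_net_family (\<lambda>t. folded (\<lambda>i. a t *\<^sub>R P i) (\<lambda>j. b t *\<^sub>R Q j))"
    (is "continuous_isometric_V_net_family ?G")
proof -
  note folds = folds1_scaleR[OF P] folds2_scaleR[OF Q]
  have "continuous_on UNIV (\<lambda>t. ?G t i j)" for i j
  proof -
    have "?G t i j = lift 0 (f i j) +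
        (a t * height (P i) (f i j) + b t * height (Q j) (f i j)) *\<^sub>R axis 3 1" for t
      by (simp add: folded_def vec_eq_iff forall_3 axis_def height_add height_scaleR)
    then show ?thesis
      by (simp only:) (intro continuous_intros cont)
  qed
  moreover have "isometric_nets (?G s) (?G t)" for s t
  proof -
    have "dual_face_area (?G t) i j =
       a t * b t * cross2 (top_view (P i - P (i-1))) (top_view (Q j - Q (j-1)))" for t i j
      by (simp add: dual_face_area_folded[OF folds] cross2_def algebra_simps)
    from this[of t] this[of s] have "dual_face_area (?G t) i j = dual_face_area (?G s) i j" for i j
      using area[of t i j s] by simp
    then show ?thesis
      by (simp add: isometric_nets_def)
  qed
  moreover have "\<not> isotropic_congruent (?G 0) (?G 1)"
  proof
    assume "isotropic_congruent (?G 0) (?G 1)"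
    from congruent_folded_dual_shift[OF folds folds this] obtain c where
      "a 1 *\<^sub>R P i + b 1 *\<^sub>R Q j = a 0 *\<^sub>R P i + b 0 *\<^sub>R Q j + c" for i j
      by blast
    then have "(a 1 - a 0) *\<^sub>R P i + (b 1 - b 0) *\<^sub>R Q j = c" for i j
      by (simp add: algebra_simps)
    then show False
      using nonconst by blast
  qed
  ultimately show ?thesis
    unfolding continuous_isometric_V_net_family_def using folded_V_net[OF folds] by blast
qed

lemma reciprocal_scaling_family:
  assumes P: "folds1 P" and Q: "folds2 Q" and "P i \<noteq> P i' \<or> Q j \<noteq> Q j'"
  shows "continuous_isometric_V_net_family
    (\<lambda>t. folded (\<lambda>i. exp t *\<^sub>R P i) (\<lambda>j. exp (- t) *\<^sub>R Q j))"
proof (rule scaled_family[OF P Q])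
  fix c
  show "\<exists>i j. (exp 1 - exp 0) *\<^sub>R P i + (exp (- 1) - exp (- 0)) *\<^sub>R Q j \<noteq> c"
  proof (rule ccontr)
    assume "\<not> ?thesis"
    then have eq: "(exp 1 - 1) *\<^sub>R P i + (exp (- 1) - 1) *\<^sub>R Q j = c" for i j
      by simp
    have "(exp 1 - 1 :: real) \<noteq> 0" "(exp (- 1) - 1 :: real) \<noteq> 0"
      by simp_all
    moreover have "(exp 1 - 1) *\<^sub>R P i = (exp 1 - 1) *\<^sub>R P i'"
      "(exp (- 1) - 1) *\<^sub>R Q j = (exp (- 1) - 1) *\<^sub>R Q j'"
      using eq[of i j, folded eq[of i' j]] eq[of i j, folded eq[of i j']] by simp_all
    ultimately show False
      using assms(3) by (simp only: scaleR_cancel_left) blast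
  qed
qed (auto intro!: continuous_intros simp: exp_minus)

text \<open>
  For a net in a single plane, scaling the constant \<open>P\<close> and \<open>Q\<close> only changes that plane, so a
  fold has to be created: the faces with \<open>i \<ge> 0\<close> turn about the line \<open>i = 0\<close>. All dual areas
  remain \<open>0\<close>, as there is no fold across the other family of lines.
\<close>

lemma single_fold_family:
  "\<exists>P. folds1 P \<and> continuous_isometric_V_net_family
    (\<lambda>t. folded (\<lambda>i. t *\<^sub>R P i) (\<lambda>j. n))"
proof -
  \<comment> \<open>The affine function \<open>l\<close> vanishes exactly on the line \<open>i = 0\<close>, which has direction \<open>d\<close>.\<close>
  define d where "d = f 0 1 - f 0 0"
  define l :: "real^3" where "l = vector [d$1, d$2, - cross2 d (f 0 0)]"
  define P where "P i = (if i \<ge> 0 then l else 0)" for i :: int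
  have "height l (f 0 0) = 0" "height l (f 0 1) = 0"
    by (simp_all add: height_alt l_def cross2_def d_def algebra_simps)
  then have l: "height l (f 0 j) = 0" for j
    using height_zero_line1[of l 0 0 j] by simp
  have "d \<noteq> 0"
    using edge_nonzero(1)[of 0 0] by (simp add: d_def)
  then have "l \<noteq> 0"
    by (auto simp: l_def vec_eq_iff forall_2 forall_3)
  have P: "folds1 P"
    unfolding folds1_def
  proof (intro allI)
    fix i j :: int
    show "height (P i) (f (i+1) j) = height (P (i+1)) (f (i+1) j)"
      using l[of j] by (cases "i = -1") (auto simp: P_def)
  qed
  have "folds2 (\<lambda>j. n)"
    by (simp add: folds2_def)
  then have "continuous_isometric_V_net_family (\<lambda>t. folded (\<lambda>i. t *\<^sub>R P i) (\<lambda>j. 1 *\<^sub>R n))"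
  proof (rule scaled_family[OF P])
    fix c
    have "P 0 \<noteq> P (-1)"
      using \<open>l \<noteq> 0\<close> by (simp add: P_def)
    then have "P 0 \<noteq> c \<or> P (-1) \<noteq> c"
      by metis
    then show "\<exists>i j::int. (1 - 0) *\<^sub>R P i + (1 - 1) *\<^sub>R n \<noteq> c"
      by auto
  qed (auto intro!: continuous_intros simp: cross2_def)
  with P show ?thesis
    by auto
qed

end

section \<open>V-nets are folded nets\<close>

lemma V_net_lift:
  assumes "Q_net F"
  shows "F i j = lift (dual_net F i j) (top_view (F i j))"
    "F (i+1) j = lift (dual_net F i j) (top_view (F (i+1) j))"
    "F i (j+1) = lift (dual_net F i j) (top_view (F i (j+1)))"
    "F (i+1) (j+1) = lift (dual_net F i j) (top_view (F (i+1) (j+1)))"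
proof -
  have "face F i j \<subseteq> dual_plane (dual_net F i j)"
    using Q_net_face_plane[OF assms, of i j] hull_subset[of "face F i j" affine]
    by (simp add: face_plane_def)
  then show "F i j = lift (dual_net F i j) (top_view (F i j))"
    "F (i+1) j = lift (dual_net F i j) (top_view (F (i+1) j))"
    "F i (j+1) = lift (dual_net F i j) (top_view (F i (j+1)))"
    "F (i+1) (j+1) = lift (dual_net F i j) (top_view (F (i+1) (j+1)))"
    by (simp_all add: face_def mem_dual_plane_iff_lift[symmetric])
qed

lemma straight_grid_V_net:
  assumes "isotropic_V_net F"
  shows "straight_grid (\<lambda>i j. top_view (F i j))"
proof -
  have Q: "Q_net F"
    using assms by (simp add: isotropic_V_net_def)
  have nc: "\<not> collinear {x, y, z}" if "\<not> collinear {lift n x, lift n y, lift n z}" for n x y z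
    using that collinear_lift_iff[of n "{x, y, z}"] by simp
  have nd: "nondegenerate_face F i j" for i j
    using Q by (simp add: Q_net_def)
  show ?thesis
  proof
    fix i j
    note nd = nd[of i j, unfolded nondegenerate_face_def]
    note L = V_net_lift[OF Q, of i j]
    show "\<not> collinear {top_view (F i j), top_view (F (i+1) j), top_view (F (i+1) (j+1))}"
      by (rule nc[of "dual_net F i j"]) (use nd in \<open>simp add: L[symmetric]\<close>)
    show "\<not> collinear {top_view (F (i+1) j), top_view (F (i+1) (j+1)), top_view (F i (j+1))}"
      by (rule nc[of "dual_net F i j"]) (use nd in \<open>simp add: L[symmetric]\<close>)
    show "\<not> collinear {top_view (F (i+1) (j+1)), top_view (F i (j+1)), top_view (F i j)}"
      by (rule nc[of "dual_net F i j"]) (use nd in \<open>simp add: L[symmetric]\<close>)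
    show "\<not> collinear {top_view (F i (j+1)), top_view (F i j), top_view (F (i+1) j)}"
      by (rule nc[of "dual_net F i j"]) (use nd in \<open>simp add: L[symmetric]\<close>)
  qed (use assms in \<open>simp_all add: isotropic_V_net_def\<close>)
qed

lemma int_fun_const:
  fixes h :: "int \<Rightarrow> 'a"
  assumes "\<And>k. h (k+1) = h k"
  shows "h k = h 0"
proof (induction k rule: int_induct[where k = 0])
  case (step2 i)
  then show ?case
    using assms[of "i - 1"] by simp
qed (simp_all add: assms)

lemma V_net_splits:
  assumes "isotropic_V_net F"
  defines "f \<equiv> \<lambda>i j. top_view (F i j)"
  obtains P Q where "straight_grid.folds1 f P" "straight_grid.folds2 f Q"
    "F = straight_grid.folded f P Q"
proof -
  have Q: "Q_net F"
    using assms by (simp add: isotropic_V_net_def)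
  interpret straight_grid f
    unfolding f_def by (rule straight_grid_V_net[OF assms(1)])
  define n where "n = dual_net F"
  define z where "z i j = F i j $ 3" for i j
  have h: "height (n i j) (f i j) = z i j" "height (n i j) (f (i+1) j) = z (i+1) j"
    "height (n i j) (f i (j+1)) = z i (j+1)" "height (n i j) (f (i+1) (j+1)) = z (i+1) (j+1)"
    for i j
    using V_net_lift[OF Q, of i j, THEN arg_cong[where f = "\<lambda>p. p$3"]]
    by (simp_all add: n_def z_def f_def)
  have fold1: "height (n (i+1) j - n i j) (f (i+1) k) = 0" for i j k
    by (rule height_zero_line1[of _ _ j]) (simp_all add: height_diff h)
  have fold2: "height (n i (j+1) - n i j) (f k (j+1)) = 0" for i j k
    by (rule height_zero_line2[of _ i]) (simp_all add: height_diff h)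
  have mixed: "n (i+1) (j+1) - n i (j+1) = n (i+1) j - n i j" for i j
    \<comment> \<open>Both sides agree on the two lines through the vertex \<open>(i+1, j+1)\<close>.\<close>
  proof (rule height_eq_imp_eq[OF not_collinear(4)[of "i+1" "j+1"]])
    show "height (n (i+1) (j+1) - n i (j+1)) (f (i+1) (j+1+1)) =
      height (n (i+1) j - n i j) (f (i+1) (j+1+1))"
      "height (n (i+1) (j+1) - n i (j+1)) (f (i+1) (j+1)) =
      height (n (i+1) j - n i j) (f (i+1) (j+1))"
      by (simp_all only: fold1)
    show "height (n (i+1) (j+1) - n i (j+1)) (f (i+1+1) (j+1)) =
      height (n (i+1) j - n i j) (f (i+1+1) (j+1))"
      using fold2[of i j "i+1+1"] fold2[of "i+1" j "i+1+1"] by (simp add: height_diff)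
  qed
  have row: "n (i+1) j - n i j = n (i+1) 0 - n i 0" for i j
    by (rule int_fun_const[of "\<lambda>j. n (i+1) j - n i j"]) (rule mixed)
  have "n (i+1) j - n (i+1) 0 = n i j - n i 0" for i j
    using row[of i j] by (simp add: algebra_simps)
  then have column: "n i j - n i 0 = n 0 j - n 0 0" for i j
    by (rule int_fun_const[of "\<lambda>i. n i j - n i 0"])
  have split: "n i j = (n i 0 - n 0 0) + n 0 j" for i j
    using column[of i j] by (simp add: algebra_simps)
  show thesis
  proof (rule that)
    show "folds1 (\<lambda>i. n i 0 - n 0 0)"
      using fold1[of _ 0] by (simp add: folds1_def height_diff)
    show "folds2 (n 0)"
      using fold2[of 0] by (simp add: folds2_def height_diff)
    show "F = folded (\<lambda>i. n i 0 - n 0 0) (n 0)"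
    proof (intro ext)
      fix i j
      show "F i j = folded (\<lambda>i. n i 0 - n 0 0) (n 0) i j"
        unfolding folded_def split[symmetric]
        using V_net_lift(1)[OF Q, of i j] by (simp add: n_def f_def)
    qed
  qed
qed

theorem proposition63:
  fixes F :: "int \<Rightarrow> int \<Rightarrow> real^3"
  assumes "isotropic_V_net F"
  shows "\<exists>G t0. continuous_isometric_V_net_family G \<and> G t0 = F"
proof -
  define f where "f i j = top_view (F i j)" for i j
  interpret straight_grid f
    unfolding f_def by (rule straight_grid_V_net[OF assms])
  obtain P Q where P: "folds1 P" and Q: "folds2 Q" and F: "F = folded P Q"
    using V_net_splits[OF assms] unfolding f_def by blast
  show ?thesis
  proof (cases "\<exists>i i' j j'. P i \<noteq> P i' \<or> Q j \<noteq> Q j'")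
    case True
    then obtain i i' j j' where "P i \<noteq> P i' \<or> Q j \<noteq> Q j'" by blast
    from reciprocal_scaling_family[OF P Q this] show ?thesis
      by (intro exI[of _ "\<lambda>t. folded (\<lambda>i. exp t *\<^sub>R P i) (\<lambda>j. exp (- t) *\<^sub>R Q j)"]
          exI[of _ 0]) (simp add: F)
  next
    case False
    then have "P = (\<lambda>i. P 0)" "Q = (\<lambda>j. Q 0)"
      by auto
    then have eq: "F = folded (\<lambda>i. P 0) (\<lambda>j. Q 0)"
      using F by metis
    obtain P' where
      "continuous_isometric_V_net_family (\<lambda>t. folded (\<lambda>i. t *\<^sub>R P' i) (\<lambda>j. P 0 + Q 0))"
      using single_fold_family by blast
    moreover have "folded (\<lambda>i. 0 *\<^sub>R P' i) (\<lambda>j. P 0 + Q 0) = F"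
      by (simp add: eq folded_def fun_eq_iff)
    ultimately show ?thesis
      by blast
  qed
qed

end
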